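(* Let $k>0$ and $\ell\ge 0$ be integers, let $S_1,\dots,S_k$ be discrete segments of length at least $2$, and let $T_1,\dots,T_\ell$ be discrete segments of length $1$. Let $X = S_1\times\dots\times S_k\times T_1\times\dots\times T_\ell \subseteq \mathbb{Z}^{k+\ell}$. Then $\mathrm{rc}(X) = 2k+\ell$.
   Context: A discrete segment of length $b-a$ is a set $\{a,a+1,\dots,b\}$ with $a,b\in\mathbb{Z}$, $a\le b$. $\mathrm{rc}(X)$ is the smallest number of facets of a polyhedron $P\subseteq\mathbb{R}^n$ with $P\cap\mathbb{Z}^n = X$. *)

theory Defs
  imports "HOL-Analysis.Analysis"
begin

definition int_points :: "(real^'n) set" where
  "int_points = {x. \<forall>i. x $ i \<in> \<int>}"

definition rc :: "(real^'n) set \<Rightarrow> nat" where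
  "rc X = (LEAST m. \<exists>P. polyhedron P \<and> P \<inter> int_points = X \<and> card {F. F facet_of P} = m)"

definition dseg :: "int \<Rightarrow> int \<Rightarrow> real set" where
  "dseg a b = real_of_int ` {a..b}"

end

(*
Lower bound: moving one coordinate of a suitable lattice point just outside its segment gives
2k + l lattice points outside X (both ends for the S_i, only the upper end for the T_j) whose
pairwise midpoints lie in the convex hull of X, so a facet inequality cuts off at most one of them.

Upper bound: number the coordinates from 0, those of S_1, ..., S_k first, and let T_m be the sum of
B^i (hi_i - x_i) over i < m, with B so large that the weights are superincreasing. The k + l tilted
lower bounds x_j >= lo_j - T_j / B^(k+l) and the k - 1 upper bounds x_i <= hi_i for i < k - 1,
together with the single inequality T_(k+l) >= 0 replacing all remaining upper bounds, cut out X
among the lattice points.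
*)

theory Submission
  imports Defs
begin

section \<open>Facet counts of polyhedra\<close>

text \<open>The segment from an interior point \<open>z\<close> to each \<open>p i\<close> leaves
  \<open>P\<close> through some facet \<open>C i\<close>. If two indices shared a facet, both
  points, and hence their midpoint, would lie strictly beyond its hyperplane, although the midpoint
  is in \<open>P\<close>. So \<open>C\<close> is injective.\<close>

lemma card_facets_ge_of_hiding_set:
  fixes P :: "'a::euclidean_space set" and p :: "'i \<Rightarrow> 'a"
  assumes P: "polyhedron P" and int: "interior P \<noteq> {}" and I: "finite I"
    and out: "\<And>i. i \<in> I \<Longrightarrow> p i \<notin> P"
    and mid: "\<And>i j. \<lbrakk>i \<in> I; j \<in> I; i \<noteq> j\<rbrakk> \<Longrightarrow> midpoint (p i) (p j) \<in> P"
  shows "card I \<le> card {F. F facet_of P}"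
proof -
  obtain z where z: "z \<in> interior P" using int by blast
  then have zP: "z \<in> P" using interior_subset by blast
  have rel: "rel_interior P = interior P"
    using int rel_interior_nonempty_interior by blast
  have "\<exists>C y. C facet_of P \<and> y \<in> C \<and> y \<in> closed_segment z (p i)" if "i \<in> I" for i
  proof -
    have "closed_segment z (p i) \<inter> frontier P \<noteq> {}"
      using zP out[OF that] by (intro connected_Int_frontier) auto
    then obtain y where y: "y \<in> closed_segment z (p i)" "y \<in> frontier P" by blast
    then have "y \<in> P - rel_interior P"
      using P rel by (simp add: frontier_def polyhedron_imp_closed)
    then show ?thesis using y rel_boundary_of_polyhedron[OF P] by blast
  qed
  then obtain C y where C: "\<And>i. i \<in> I \<Longrightarrow> C i facet_of P"
    and y: "\<And>i. i \<in> I \<Longrightarrow> y i \<in> C i" "\<And>i. i \<in> I \<Longrightarrow> y i \<in> closed_segment z (p i)"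
    by metis
  have "inj_on C I"
  proof (rule inj_onI, rule ccontr)
    fix i j assume ij: "i \<in> I" "j \<in> I" "C i = C j" "i \<noteq> j"
    have Cf: "C i face_of P" "C i \<noteq> P" using C[OF ij(1)] by (auto simp: facet_of_def)
    obtain a b where ab: "P \<subseteq> {x. a \<bullet> x \<le> b}" "C i = P \<inter> {x. a \<bullet> x = b}"
      using facet_of_polyhedron[OF P C[OF ij(1)]] by metis
    have "z \<notin> C i" using face_of_disjoint_interior[OF Cf] z by blast
    then have az: "a \<bullet> z < b" using ab zP by force
    \<comment> \<open>The function \<open>a \<bullet> x\<close> is below \<open>b\<close> at
      \<open>z\<close> and equals \<open>b\<close> at \<open>y l\<close>, which lies strictly
      between \<open>z\<close> and \<open>p l\<close>, so it exceeds \<open>b\<close> at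
      \<open>p l\<close>.\<close>
    have beyond: "a \<bullet> p l > b" if l: "l \<in> I" "y l \<in> C i" for l
    proof -
      obtain t where t: "0 \<le> t" "t \<le> 1" and yt: "y l = (1 - t) *\<^sub>R z + t *\<^sub>R p l"
        using y(2)[OF l(1)] by (auto simp: in_segment)
      have "t \<noteq> 1" using yt l ab out by auto
      moreover have "t \<noteq> 0" using yt l \<open>z \<notin> C i\<close> by auto
      moreover have "(1 - t) * (a \<bullet> z) + t * (a \<bullet> p l) = b"
        using l ab yt by (auto simp: inner_add_right)
      moreover have "(1 - t) * (a \<bullet> z) < (1 - t) * b"
        using az t \<open>t \<noteq> 1\<close> by (intro mult_strict_left_mono) auto
      ultimately have "t * (a \<bullet> p l) > t * b" by (simp add: algebra_simps)
      then show ?thesis using t \<open>t \<noteq> 0\<close> by simp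
    qed
    have "a \<bullet> p i > b" "a \<bullet> p j > b" using beyond ij y by auto
    then have "a \<bullet> midpoint (p i) (p j) > b"
      by (simp add: midpoint_def inner_add_right)
    moreover have "midpoint (p i) (p j) \<in> P" using mid ij by blast
    ultimately show False using ab by force
  qed
  moreover have "C ` I \<subseteq> {F. F facet_of P}" using C by blast
  ultimately show ?thesis
    using card_inj_on_le finite_polyhedron_facets[OF P] by blast
qed

text \<open>Every facet has the form \<open>\<Inter>H \<inter> frontier h\<close> with
  \<open>h \<in> H\<close>: a relative interior point of the facet lies on the frontier of some
  \<open>h\<close>, and the proper face cut out there contains the facet, so it equals it by
  dimension.\<close>

lemma card_facets_le_of_Inter_halfspaces:
  fixes H :: "'a::euclidean_space set set"
  assumes H: "finite H" and half: "\<And>h. h \<in> H \<Longrightarrow> \<exists>a b. h = {x. a \<bullet> x \<le> b}"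
    and int: "interior (\<Inter>H) \<noteq> {}"
  shows "card {F. F facet_of \<Inter>H} \<le> card H"
proof -
  let ?P = "\<Inter>H"
  have poly: "polyhedron ?P"
    using H half polyhedron_halfspace_le by (metis polyhedron_Inter)
  then have conv: "convex ?P" by (rule polyhedron_imp_convex)
  have "C \<in> (\<lambda>h. ?P \<inter> frontier h) ` H" if C: "C facet_of ?P" for C
  proof -
    have face: "C face_of ?P" and ne: "C \<noteq> {}" "C \<noteq> ?P"
      and dimC: "aff_dim C = aff_dim ?P - 1"
      using C by (auto simp: facet_of_def)
    have "rel_interior C \<noteq> {}"
      using face ne by (simp add: face_of_imp_convex rel_interior_eq_empty)
    then obtain y where y: "y \<in> rel_interior C" by blast
    then have yC: "y \<in> C" using rel_interior_subset by blast
    then have yP: "y \<in> ?P" using face face_of_imp_subset by blast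
    have "y \<notin> interior ?P" using face_of_disjoint_interior[OF face ne(2)] yC by blast
    moreover have "open (\<Inter>(interior ` H))" using H by (intro open_Inter) auto
    moreover have "\<Inter>(interior ` H) \<subseteq> ?P" using interior_subset by blast
    ultimately have "y \<notin> \<Inter>(interior ` H)" by (meson interiorI)
    then obtain h where h: "h \<in> H" "y \<notin> interior h" by blast
    obtain a b where ab: "h = {x. a \<bullet> x \<le> b}" using half h by blast
    \<comment> \<open>With \<open>a = 0\<close> the set \<open>h\<close> would be empty or the whole
      space; the first contradicts \<open>y \<in> h\<close>, the second
      \<open>y \<notin> interior h\<close>.\<close>
    have "a \<noteq> 0" using h ab yP by (cases "0 \<le> b") auto
    then have fr: "frontier h = {x. a \<bullet> x = b}" by (simp add: ab frontier_halfspace_le)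
    have yfr: "y \<in> frontier h" using h yP closure_subset by (auto simp: frontier_def)
    have D: "?P \<inter> frontier h face_of ?P"
      unfolding fr using h ab by (intro face_of_Int_supporting_hyperplane_le[OF conv]) auto
    \<comment> \<open>A face of \<open>?P\<close> through the relative interior point
      \<open>y\<close> of \<open>C\<close> contains all of \<open>C\<close>.\<close>
    have sub: "C \<subseteq> ?P \<inter> frontier h"
      using y yP yfr face by (intro subset_of_face_of[OF D]) (auto dest: face_of_imp_subset)
    have "?P \<inter> frontier h \<noteq> ?P"
    proof
      assume "?P \<inter> frontier h = ?P"
      then have "interior ?P \<subseteq> interior (frontier h)" by (metis interior_mono inf_le2)
      then show False using int \<open>a \<noteq> 0\<close> fr by simp
    qed
    then have "aff_dim (?P \<inter> frontier h) < aff_dim ?P"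
      by (rule face_of_aff_dim_lt[OF conv D])
    moreover have "C face_of ?P \<inter> frontier h"
      using face_of_subset[OF face sub] by blast
    \<comment> \<open>A proper inclusion would be a second drop in dimension below
      \<open>?P\<close>, but a facet has codimension one.\<close>
    ultimately have "C = ?P \<inter> frontier h"
      using face_of_aff_dim_lt[OF face_of_imp_convex[OF D]] dimC by fastforce
    then show ?thesis using h by blast
  qed
  then have "{F. F facet_of ?P} \<subseteq> (\<lambda>h. ?P \<inter> frontier h) ` H" by blast
  then show ?thesis using H surj_card_le by blast
qed

section \<open>Boxes from their vertices and from chained inequalities\<close>

text \<open>Induction on the set of coordinates that may be non-extreme: pushing one of them to
  either end gives two points of \<open>S\<close> whose segment contains \<open>x\<close>.\<close>

lemma cbox_subset_of_vertices:
  fixes S :: "(real^'n) set" and a b :: "real^'n"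
  assumes S: "convex S" and ab: "\<And>i. a $ i \<le> b $ i"
    and vert: "\<And>x. (\<And>i. x $ i \<in> {a $ i, b $ i}) \<Longrightarrow> x \<in> S"
  shows "cbox a b \<subseteq> S"
proof -
  have "x \<in> S" if "finite A" "\<And>i. x $ i \<in> {a $ i..b $ i}" "\<And>i. i \<notin> A \<Longrightarrow> x $ i \<in> {a $ i, b $ i}"
    for A and x :: "real^'n"
    using that
  proof (induction A arbitrary: x rule: finite_induct)
    case empty
    then show ?case using vert by blast
  next
    case (insert j A)
    define u where "u s = (\<chi> i. if i = j then s else x $ i)" for s
    have "u s \<in> S" if "s \<in> {a $ j, b $ j}" for s
      using that insert.prems ab by (intro insert.IH) (auto simp: u_def)
    then have "closed_segment (u (a $ j)) (u (b $ j)) \<subseteq> S"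
      by (intro closed_segment_subset S) auto
    moreover obtain t where t: "0 \<le> t" "t \<le> 1" "x $ j = (1 - t) *\<^sub>R a $ j + t *\<^sub>R b $ j"
      using insert.prems(1)[of j] ab[of j] closed_segment_eq_real_ivl1[of "a $ j" "b $ j"]
      by (auto simp: in_segment set_eq_iff)
    then have "x = (1 - t) *\<^sub>R u (a $ j) + t *\<^sub>R u (b $ j)"
      by (auto simp: vec_eq_iff u_def algebra_simps)
    then have "x \<in> closed_segment (u (a $ j)) (u (b $ j))"
      using t unfolding in_segment by blast
    ultimately show ?case by blast
  qed
  from this[of UNIV] show ?thesis by (auto simp: mem_box_cart)
qed

text \<open>Induction on the rank. With all earlier coordinates in range,
  \<open>0 \<le> T m < B ^ m\<close>, so the tilt in \<open>lower\<close> is worth less than one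
  unit and an integer cannot drop below \<open>lo i\<close>. An overshoot past a missing upper bound
  makes \<open>T\<close> negative up to \<open>N\<close>, against \<open>total\<close>.\<close>

lemma int_box_of_chain:
  fixes z lo hi :: "'n::finite \<Rightarrow> int" and r :: "'n \<Rightarrow> nat" and B :: int and T :: "nat \<Rightarrow> int"
  assumes r: "inj r" "\<And>i. r i < N"
    and h: "\<And>i. lo i \<le> hi i" "\<And>i. k \<le> r i \<Longrightarrow> hi i = lo i + 1"
    and B: "(\<Sum>i\<in>UNIV. hi i - lo i) < B"
    and T: "\<And>m. T m = (\<Sum>i | r i < m. B ^ r i * (hi i - z i))"
    and lower: "\<And>i. 0 \<le> B ^ N * (z i - lo i) + T (r i)"
    and upper: "\<And>i. Suc (r i) < k \<Longrightarrow> z i \<le> hi i"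
    and total: "0 \<le> T N"
  shows "z i \<in> {lo i..hi i}"
proof -
  have B1: "1 \<le> B" using B sum_nonneg[of UNIV "\<lambda>i. hi i - lo i"] h(1) by force
  have Tstep: "T (Suc (r i)) = T (r i) + B ^ r i * (hi i - z i)" for i
  proof -
    have "{j. r j < Suc (r i)} = insert i {j. r j < r i}"
      using r(1) by (auto simp: less_Suc_eq inj_eq)
    then show ?thesis by (simp add: T)
  qed
  have "\<forall>i. r i < m \<longrightarrow> z i \<in> {lo i..hi i}" for m
  proof (induction m)
    case 0
    then show ?case by simp
  next
    case (Suc m)
    have "z i \<in> {lo i..hi i}" if i: "r i = m" for i
    proof -
      have T0: "0 \<le> T m" unfolding T using Suc B1 by (intro sum_nonneg) auto
      \<comment> \<open>After multiplication by \<open>B\<close> every weight is still at most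
        \<open>B ^ m\<close>, so the sum is bounded by \<open>B ^ m\<close> times the total length,
        which is less than \<open>B\<close>.\<close>
      have "B * T m = (\<Sum>j | r j < m. B ^ Suc (r j) * (hi j - z j))"
        by (simp add: T sum_distrib_left mult.assoc)
      also have "\<dots> \<le> (\<Sum>j | r j < m. B ^ m * (hi j - lo j))"
        using Suc B1 by (intro sum_mono mult_mono power_increasing) auto
      also have "\<dots> \<le> (\<Sum>j\<in>UNIV. B ^ m * (hi j - lo j))"
        using B1 h by (intro sum_mono2) auto
      also have "\<dots> < B ^ m * B"
        using B B1 by (simp flip: sum_distrib_left)
      finally have Tm: "T m < B ^ m" using B1 by (simp add: mult.commute)
      have "B ^ m \<le> B ^ N" using B1 r(2)[of i] i by (intro power_increasing) auto
      then have "B ^ N * (- 1) < B ^ N * (z i - lo i)" using lower[of i] Tm i by simp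
      then have "- 1 < z i - lo i" using B1 by (subst (asm) mult_less_cancel_left_pos) auto
      moreover have "z i \<le> hi i"
      proof (rule ccontr)
        assume gt: "\<not> z i \<le> hi i"
        \<comment> \<open>Explicit upper bounds stop before rank \<open>k - 1\<close>, so an
          overshoot occurs at the last long coordinate or later, and all coordinates after it have
          length 1.\<close>
        then have k: "k \<le> Suc m" using upper[of i] i by force
        \<comment> \<open>By integrality the overshoot is at least one unit, and its cost
          \<open>B ^ m\<close> exceeds all the slack \<open>T m\<close> gathered so far.\<close>
        have "B ^ m * (hi i - z i) \<le> B ^ m * (- 1)"
          using gt B1 by (intro mult_left_mono) auto
        then have neg: "T (Suc m) < 0" using Tstep[of i] Tm i by simp
        \<comment> \<open>The deficit persists: once the partial sum is negative, each later lower bound forces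
          \<open>z j \<ge> lo j + 1 = hi j\<close>.\<close>
        have "T q < 0" if "Suc m \<le> q" for q
          using that
        proof (induction q rule: dec_induct)
          case base
          then show ?case by (rule neg)
        next
          case (step q)
          show ?case
          proof (cases "\<exists>j. r j = q")
            case True
            then obtain j where j: "r j = q" by blast
            have "0 < B ^ N * (z j - lo j)" using lower[of j] step j by simp
            then have "lo j < z j" using B1 by (simp add: zero_less_mult_iff)
            moreover have "hi j = lo j + 1" using h(2)[of j] k step j by simp
            ultimately have "B ^ q * (hi j - z j) \<le> 0"
              using B1 by (intro mult_nonneg_nonpos) auto
            then show ?thesis using Tstep[of j] step j by simp
          next
            case False
            then have "{j. r j < Suc q} = {j. r j < q}" by (auto simp: less_Suc_eq)
            then show ?thesis using step by (simp add: T)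
          qed
        qed
        then have "T N < 0" using r(2)[of i] i by simp
        then show False using total by simp
      qed
      ultimately show ?thesis by simp
    qed
    then show ?case using Suc by (auto simp: less_Suc_eq)
  qed
  then show ?thesis using r(2) by blast
qed

section \<open>Lower bound on the number of facets\<close>

lemma mem_dseg_iff: "x \<in> dseg a b \<longleftrightarrow> x \<in> \<int> \<and> of_int a \<le> x \<and> x \<le> of_int b"
  by (auto simp: dseg_def elim!: Ints_cases)

lemma dseg_box_le_card_facets:
  fixes lo hi :: "'n::finite \<Rightarrow> int" and K :: "'n set"
  assumes K: "\<And>i. i \<in> K \<Longrightarrow> hi i - lo i \<ge> 2"
    and notK: "\<And>i. i \<notin> K \<Longrightarrow> hi i - lo i = 1"
    and P: "polyhedron P" "P \<inter> int_points = {x :: real^'n. \<forall>i. x $ i \<in> dseg (lo i) (hi i)}"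
  shows "2 * card K + (CARD('n) - card K) \<le> card {F. F facet_of P}"
proof -
  have lohi: "lo i < hi i" for i using K[of i] notK[of i] by (cases "i \<in> K") auto
  define a b :: "real^'n" where "a = (\<chi> i. of_int (lo i))" and "b = (\<chi> i. of_int (hi i))"
  \<comment> \<open>The vertices of the real box are lattice points of X, so convexity puts the
    whole box into \<open>P\<close>. This yields both the nonempty interior and the membership of
    the midpoints.\<close>
  have "x \<in> P" if "\<And>i. x $ i \<in> {a $ i, b $ i}" for x
  proof -
    have "x $ i \<in> dseg (lo i) (hi i)" for i
      using that[of i] lohi[of i] by (auto simp: a_def b_def mem_dseg_iff)
    then have "x \<in> P \<inter> int_points" unfolding P(2) by blast
    then show ?thesis by simp
  qed
  then have box: "cbox a b \<subseteq> P"
    using lohi by (intro cbox_subset_of_vertices polyhedron_imp_convex P(1))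
      (auto simp: a_def b_def less_imp_le)
  have "box a b \<noteq> {}" using lohi by (simp add: interval_ne_empty_cart a_def b_def)
  then have int: "interior P \<noteq> {}"
    using interior_mono[OF box] by (auto simp: interior_cbox)
  \<comment> \<open>The base point leaves a margin of one below it on \<open>K\<close>. There
    \<open>lo i + 1\<close> averages with \<open>lo i - 1\<close> to \<open>lo i\<close>, and with
    \<open>hi i + 1\<close> to at most \<open>hi i\<close> because the length is at least 2; for
    length 1, \<open>lo i\<close> and \<open>hi i + 1\<close> average to
    \<open>hi i\<close>.\<close>
  define c where "c i = (if i \<in> K then lo i + 1 else lo i)" for i
  define p :: "'n \<times> bool \<Rightarrow> real^'n" where
    "p = (\<lambda>(i, s). \<chi> j. of_int (if j = i then if s then hi i + 1 else lo i - 1 else c j))"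
  \<comment> \<open>Lower exits are used only on \<open>K\<close>: for length 1 the average of
    \<open>lo i - 1\<close> and \<open>lo i\<close> would fall below the segment.\<close>
  define I where "I = K \<times> {False} \<union> UNIV \<times> {True}"
  have "card I = card K + CARD('n)"
    unfolding I_def by (subst card_Un_disjoint) (auto simp: card_cartesian_product)
  moreover have "card K \<le> CARD('n)" by (intro card_mono) auto
  moreover have "card I \<le> card {F. F facet_of P}"
  proof (rule card_facets_ge_of_hiding_set[OF P(1) int])
    show "p i \<notin> P" if "i \<in> I" for i
    proof
      assume "p i \<in> P"
      then have "p i \<in> P \<inter> int_points" by (auto simp: int_points_def p_def split: prod.split)
      then have "p i $ fst i \<in> dseg (lo (fst i)) (hi (fst i))" unfolding P(2) by blast
      then show False by (auto simp: p_def mem_dseg_iff split: prod.splits if_splits)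
    qed
    show "midpoint (p u) (p v) \<in> P" if "u \<in> I" "v \<in> I" "u \<noteq> v" for u v
    proof -
      obtain i s j t where uv: "u = (i, s)" "v = (j, t)" by fastforce
      \<comment> \<open>This is twice the midpoint, so the comparison with the box takes place in
        the integers.\<close>
      define x where "x l = (if l = i then if s then hi i + 1 else lo i - 1 else c l)
        + (if l = j then if t then hi j + 1 else lo j - 1 else c l)" for l
      have "2 * lo l \<le> x l \<and> x l \<le> 2 * hi l" for l
        using that K[of l] notK[of l] lohi[of l]
        by (auto simp: x_def c_def uv I_def)
      then have "real_of_int (2 * lo l) \<le> of_int (x l) \<and> real_of_int (x l) \<le> of_int (2 * hi l)" for l
        by (simp only: of_int_le_iff)
      moreover have "midpoint (p u) (p v) $ l = of_int (x l) / 2" for l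
        by (simp add: midpoint_def p_def x_def uv)
      ultimately have "midpoint (p u) (p v) \<in> cbox a b"
        by (simp add: mem_box_cart a_def b_def mult.commute del: eq_divide_eq_numeral1)
      then show ?thesis using box by blast
    qed
  qed (simp add: I_def)
  ultimately show ?thesis by simp
qed

section \<open>Upper bound: a tilted polyhedron\<close>

text \<open>Numbers the long coordinates first, by joining an enumeration of \<open>K\<close> with a
  shifted one of its complement; the chain argument needs every rank from \<open>card K\<close> on
  to have length 1.\<close>

lemma ex_rank_initial_segment:
  fixes K :: "'n::finite set"
  obtains r :: "'n \<Rightarrow> nat" where "inj r" "\<And>i. r i < CARD('n)" "\<And>i. i \<in> K \<longleftrightarrow> r i < card K"
proof -
  obtain f where f: "bij_betw f K {0..<card K}"
    using ex_bij_betw_finite_nat[of K] by auto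
  obtain g where g: "bij_betw g (- K) {0..<card (- K)}"
    using ex_bij_betw_finite_nat[of "- K"] by auto
  have cardK: "card K + card (- K) = CARD('n)"
    using card_Un_disjoint[of K "- K"] by (simp add: Compl_partition)
  define r where "r i = (if i \<in> K then f i else card K + g i)" for i
  have fK: "f i < card K" if "i \<in> K" for i using f that by (auto dest: bij_betwE)
  have gK: "g i < card (- K)" if "i \<notin> K" for i using g that by (auto dest: bij_betwE)
  show thesis
  proof
    show "inj r"
    proof (rule injI)
      fix i j assume "r i = r j"
      then show "i = j"
        using f g fK[of i] fK[of j]
        by (auto simp: r_def bij_betw_def inj_on_def split: if_splits)
    qed
    show "r i < CARD('n)" for i
      using fK[of i] gK[of i] cardK by (auto simp: r_def)
    show "i \<in> K \<longleftrightarrow> r i < card K" for i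
      using fK[of i] by (auto simp: r_def)
  qed
qed

text \<open>The half-spaces in \<open>H\<close> contain the whole real box, which supplies X and a
  nonempty interior; \<open>int_box_of_chain\<close> rules out every other lattice point.\<close>

lemma dseg_box_ex_polyhedron:
  fixes lo hi :: "'n::finite \<Rightarrow> int" and K :: "'n set"
  assumes K0: "card K > 0"
    and K: "\<And>i. i \<in> K \<Longrightarrow> hi i - lo i \<ge> 2"
    and notK: "\<And>i. i \<notin> K \<Longrightarrow> hi i - lo i = 1"
  obtains P where "polyhedron P"
    and "P \<inter> int_points = {x :: real^'n. \<forall>i. x $ i \<in> dseg (lo i) (hi i)}"
    and "card {F. F facet_of P} \<le> 2 * card K + (CARD('n) - card K)"
proof -
  have lohi: "lo i < hi i" for i using K[of i] notK[of i] by (cases "i \<in> K") auto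
  obtain r :: "'n \<Rightarrow> nat" where r: "inj r" "\<And>i. r i < CARD('n)"
    and rK: "\<And>i. i \<in> K \<longleftrightarrow> r i < card K"
    using ex_rank_initial_segment by blast
  define N where "N = CARD('n)"
  define B where "B = (\<Sum>i\<in>UNIV. hi i - lo i) + 1"
  have B0: "0 < B"
    using lohi sum_nonneg[of UNIV "\<lambda>i. hi i - lo i"] by (force simp: B_def less_imp_le)
  define S :: "nat \<Rightarrow> real^'n \<Rightarrow> real" where
    "S m x = (\<Sum>i | r i < m. of_int B ^ r i * (of_int (hi i) - x $ i))" for m x
  \<comment> \<open>The tilted lower bound is scaled by \<open>B ^ N\<close>, so that its
    coefficients are integers.\<close>
  define L where "L j = {x. 0 \<le> of_int B ^ N * (x $ j - of_int (lo j)) + S (r j) x}" for j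
  define U :: "'n \<Rightarrow> (real^'n) set" where "U j = {x. x $ j \<le> of_int (hi j)}" for j
  \<comment> \<open>The last long coordinate is left out: its upper bound is among those replaced by
    \<open>0 \<le> S N x\<close>.\<close>
  define J where "J = {j. Suc (r j) < card K}"
  define H where "H = insert {x. 0 \<le> S N x} (range L \<union> U ` J)"
  have fin: "finite H" by (simp add: H_def)
  \<comment> \<open>Normal vector and offset that exhibit \<open>S m\<close> as an affine function,
    needed for the half-space form.\<close>
  define v :: "nat \<Rightarrow> real^'n" where "v m = (\<chi> i. if r i < m then of_int B ^ r i else 0)" for m
  define d where "d m = (\<Sum>i | r i < m. of_int B ^ r i * real_of_int (hi i))" for m
  have S_eq: "S m x = d m - v m \<bullet> x" for m x
  proof -
    have "v m \<bullet> x = (\<Sum>i\<in>UNIV. if r i < m then of_int B ^ r i * x $ i else 0)"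
      by (auto simp: inner_vec_def v_def intro!: sum.cong)
    also have "\<dots> = (\<Sum>i | r i < m. of_int B ^ r i * x $ i)"
      using sum.inter_filter[of UNIV "\<lambda>i. of_int B ^ r i * x $ i" "\<lambda>i. r i < m"] by simp
    finally show ?thesis by (simp add: S_def d_def right_diff_distrib sum_subtractf)
  qed
  have half: "\<exists>a b. h = {x. a \<bullet> x \<le> b}" if "h \<in> H" for h
  proof -
    have "{x. 0 \<le> S N x} = {x. v N \<bullet> x \<le> d N}" by (auto simp: S_eq)
    moreover have "L j = {x. (v (r j) - axis j (of_int B ^ N)) \<bullet> x \<le> d (r j) - of_int B ^ N * of_int (lo j)}" for j
      by (auto simp: L_def S_eq inner_diff_left inner_axis' algebra_simps)
    moreover have "U j = {x. axis j 1 \<bullet> x \<le> of_int (hi j)}" for j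
      by (auto simp: U_def inner_axis')
    ultimately show ?thesis using that unfolding H_def by blast
  qed
  have poly: "polyhedron (\<Inter>H)"
    using fin half polyhedron_halfspace_le by (metis polyhedron_Inter)
  define a b :: "real^'n" where "a = (\<chi> i. of_int (lo i))" and "b = (\<chi> i. of_int (hi i))"
  have box: "cbox a b \<subseteq> \<Inter>H"
  proof
    fix x assume "x \<in> cbox a b"
    then have x: "of_int (lo i) \<le> x $ i" "x $ i \<le> of_int (hi i)" for i
      by (auto simp: mem_box_cart a_def b_def)
    \<comment> \<open>Each summand is nonnegative on the box, so the tilts only relax the lower
      bounds there.\<close>
    then have "0 \<le> S m x" for m
      unfolding S_def using B0 by (intro sum_nonneg) auto
    then show "x \<in> \<Inter>H" using x B0 by (auto simp: H_def L_def U_def)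
  qed
  have "box a b \<noteq> {}" using lohi by (simp add: interval_ne_empty_cart a_def b_def)
  then have int: "interior (\<Inter>H) \<noteq> {}"
    using interior_mono[OF box] by (auto simp: interior_cbox)
  have "\<Inter>H \<inter> int_points = {x. \<forall>i. x $ i \<in> dseg (lo i) (hi i)}"
  proof (intro equalityI subsetI)
    fix x :: "real^'n" assume x: "x \<in> \<Inter>H \<inter> int_points"
    then have "\<forall>i. \<exists>z. x $ i = of_int z" by (auto simp: int_points_def Ints_def)
    then obtain z where z: "\<And>i. x $ i = of_int (z i)" by metis
    define T where "T m = (\<Sum>i | r i < m. B ^ r i * (hi i - z i))" for m
    have ST: "S m x = of_int (T m)" for m by (simp add: S_def T_def z)
    have "z i \<in> {lo i..hi i}" for i
    proof (rule int_box_of_chain[where T = T, OF r])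
      show "lo i \<le> hi i" for i using lohi less_imp_le by blast
      show "hi i = lo i + 1" if "card K \<le> r i" for i
        using that notK[of i] rK[of i] by simp
      show "0 \<le> B ^ CARD('n) * (z i - lo i) + T (r i)" for i
      proof -
        have "x \<in> L i" using x by (auto simp: H_def)
        then have "0 \<le> real_of_int (B ^ N * (z i - lo i) + T (r i))"
          by (simp add: L_def ST z)
        then show ?thesis by (simp only: of_int_0_le_iff N_def)
      qed
      show "z i \<le> hi i" if "Suc (r i) < card K" for i
      proof -
        have "x \<in> U i" using x that by (auto simp: H_def J_def)
        then show ?thesis by (simp add: U_def z)
      qed
      show "0 \<le> T CARD('n)" using x by (auto simp: H_def ST N_def)
    qed (auto simp: B_def T_def)
    then show "x \<in> {x. \<forall>i. x $ i \<in> dseg (lo i) (hi i)}"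
      by (auto simp: mem_dseg_iff z)
  next
    fix x :: "real^'n" assume "x \<in> {x. \<forall>i. x $ i \<in> dseg (lo i) (hi i)}"
    then have "x \<in> cbox a b" "x \<in> int_points"
      by (auto simp: mem_dseg_iff mem_box_cart a_def b_def int_points_def)
    then show "x \<in> \<Inter>H \<inter> int_points" using box by blast
  qed
  moreover have "card {F. F facet_of \<Inter>H} \<le> 2 * card K + (CARD('n) - card K)"
  proof -
    have "card J \<le> card {..<card K - 1}"
      by (rule card_inj_on_le[where f = r])
        (use r(1) in \<open>auto simp: J_def intro: inj_on_subset\<close>)
    then have "card (U ` J) \<le> card K - 1" using card_image_le[of J U] by simp
    moreover have "card (range L) \<le> CARD('n)" by (intro card_image_le) simp
    moreover have "card H \<le> Suc (card (range L \<union> U ` J))"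
      unfolding H_def by (rule card_insert_le_m1) auto
    moreover have "card (range L \<union> U ` J) \<le> card (range L) + card (U ` J)" by (rule card_Un_le)
    moreover have "card K \<le> CARD('n)" by (intro card_mono) auto
    \<comment> \<open>The total is \<open>CARD('n) + (card K - 1) + 1\<close>; positivity of
      \<open>card K\<close> keeps the truncated subtraction exact.\<close>
    ultimately have "card H \<le> 2 * card K + (CARD('n) - card K)" using K0 by linarith
    then show ?thesis
      using card_facets_le_of_Inter_halfspaces[OF fin half int] by linarith
  qed
  ultimately show thesis using that poly by blast
qed

text \<open>Coordinates are indexed by a finite type with \<open>K\<close> marking the long
  segments, so \<open>card K\<close> is k and \<open>CARD('n) - card K\<close> is l.\<close>

theorem theorem5p2:
  fixes lo hi :: "'n::finite \<Rightarrow> int" and K :: "'n set"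
  assumes "card K > 0"
    and "\<And>i. i \<in> K \<Longrightarrow> hi i - lo i \<ge> 2"
    and "\<And>i. i \<notin> K \<Longrightarrow> hi i - lo i = 1"
  shows "rc {x :: real^'n. \<forall>i. x $ i \<in> dseg (lo i) (hi i)} = 2 * card K + (CARD('n) - card K)"
proof -
  obtain P where P: "polyhedron P"
    "P \<inter> int_points = {x :: real^'n. \<forall>i. x $ i \<in> dseg (lo i) (hi i)}"
    "card {F. F facet_of P} \<le> 2 * card K + (CARD('n) - card K)"
    by (rule dseg_box_ex_polyhedron[OF assms])
  have lower: "2 * card K + (CARD('n) - card K) \<le> card {F. F facet_of Q}"
    if "polyhedron Q" "Q \<inter> int_points = {x :: real^'n. \<forall>i. x $ i \<in> dseg (lo i) (hi i)}" for Q
    by (rule dseg_box_le_card_facets[OF assms(2,3) that])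
  show ?thesis
    unfolding rc_def
  proof (rule Least_equality)
    show "\<exists>P. polyhedron P \<and> P \<inter> int_points = {x :: real^'n. \<forall>i. x $ i \<in> dseg (lo i) (hi i)} \<and>
        card {F. F facet_of P} = 2 * card K + (CARD('n) - card K)"
      \<comment> \<open>\<open>LEAST\<close> asks for an exact count: the construction bounds the
        facets of \<open>P\<close> from above, \<open>lower\<close> from below.\<close>
      using P lower[OF P(1,2)] by (intro exI[of _ P] conjI) auto
  qed (use lower in auto)
qed

end
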